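(* Let $G$ be a finitely generated group that is quasi-isometric to $\mathbb{R}$. Then $G$ is virtually $\mathbb{Z}$, i.e. $G$ has a finite-index subgroup isomorphic to $\mathbb{Z}$.
   Context: A map $f:X\to Y$ of metric spaces is a $(\lambda,\epsilon)$ quasi-isometric embedding, where $\lambda\ge 1$, $\epsilon\ge 0$, if $\frac1\lambda d_X(a,b)-\epsilon\le d_Y(f(a),f(b))\le\lambda d_X(a,b)+\epsilon$ for all $a,b\in X$. A subset $Y\subseteq X$ of a metric space is quasi-dense if there is $k\ge 0$ such that every point of $X$ is within distance $k$ of a point of $Y$. A quasi-isometry is a quasi-isometric embedding (for some $\lambda,\epsilon$) with quasi-dense image. No continuity is assumed. For a group $G$ with generating set $S$, the Cayley graph $\Gamma_S$ has vertex set $G$, with an edge joining $g$ and $g'$ exactly when $g=sg'$ or $g'=sg$ for some $s\in S$; it carries the path metric in which each edge has length $1$. "$G$ is quasi-isometric to $\mathbb{R}$" means that some (equivalently, any) Cayley graph of $G$ with respect to a finite generating set admits a quasi-isometry to $\mathbb{R}$ (with its usual metric). *)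

theory Defs
  imports "HOL-Analysis.Analysis" "HOL-Algebra.Elementary_Groups"
begin

definition quasi_isometric_embedding ::
  "real \<Rightarrow> real \<Rightarrow> 'a metric \<Rightarrow> 'b metric \<Rightarrow> ('a \<Rightarrow> 'b) \<Rightarrow> bool" where
  "quasi_isometric_embedding L \<epsilon> X Y f \<longleftrightarrow>
     1 \<le> L \<and> 0 \<le> \<epsilon> \<and> f \<in> mspace X \<rightarrow> mspace Y \<and>
     (\<forall>a\<in>mspace X. \<forall>b\<in>mspace X.
        1 / L * mdist X a b - \<epsilon> \<le> mdist Y (f a) (f b) \<and>
        mdist Y (f a) (f b) \<le> L * mdist X a b + \<epsilon>)"

definition quasi_dense :: "'a metric \<Rightarrow> 'a set \<Rightarrow> bool" where
  "quasi_dense X Y \<longleftrightarrow>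
     Y \<subseteq> mspace X \<and> (\<exists>k\<ge>0. \<forall>x\<in>mspace X. \<exists>y\<in>Y. mdist X x y \<le> k)"

definition quasi_isometry :: "'a metric \<Rightarrow> 'b metric \<Rightarrow> ('a \<Rightarrow> 'b) \<Rightarrow> bool" where
  "quasi_isometry X Y f \<longleftrightarrow>
     (\<exists>L \<epsilon>. quasi_isometric_embedding L \<epsilon> X Y f) \<and> quasi_dense Y (f ` mspace X)"

text \<open>
  A graph has a vertex set \<open>V\<close> and a symmetric adjacency relation \<open>E\<close>. Its geometric realization
  is described by barycentric coordinates: a point is a function on vertices that is supported on
  a single vertex or on the two ends of an edge, is nonnegative, and has total mass 1. The vertex
  \<open>v\<close> is the point mass at \<open>v\<close>. There is one segment for each pair of distinct adjacent vertices;
  a loop \<open>E v v\<close> contributes only the vertex \<open>v\<close>.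
\<close>

definition graph_cell :: "'a \<Rightarrow> 'a \<Rightarrow> ('a \<Rightarrow> real) set" where
  "graph_cell v w =
     {p. (\<forall>x. 0 \<le> p x) \<and> (\<forall>x. x \<notin> {v, w} \<longrightarrow> p x = 0) \<and> (\<Sum>x\<in>{v, w}. p x) = 1}"

definition is_cell :: "'a set \<Rightarrow> ('a \<Rightarrow> 'a \<Rightarrow> bool) \<Rightarrow> 'a \<Rightarrow> 'a \<Rightarrow> bool" where
  "is_cell V E v w \<longleftrightarrow> v \<in> V \<and> w \<in> V \<and> (v = w \<or> E v w)"

definition graph_points :: "'a set \<Rightarrow> ('a \<Rightarrow> 'a \<Rightarrow> bool) \<Rightarrow> ('a \<Rightarrow> real) set" where
  "graph_points V E = {p. \<exists>v w. is_cell V E v w \<and> p \<in> graph_cell v w}"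

definition graph_vertex :: "'a \<Rightarrow> 'a \<Rightarrow> real" where
  "graph_vertex v = (\<lambda>x. if x = v then 1 else 0)"

text \<open>
  \<open>graph_path V E p l q\<close>: there is a path of length \<open>l\<close> from \<open>p\<close> to \<open>q\<close> that is a concatenation
  of finitely many straight pieces, each inside one edge. On the edge with ends \<open>v\<close>, \<open>w\<close> the
  coordinate at \<open>v\<close> identifies the edge with the unit interval.
\<close>

inductive graph_path ::
  "'a set \<Rightarrow> ('a \<Rightarrow> 'a \<Rightarrow> bool) \<Rightarrow> ('a \<Rightarrow> real) \<Rightarrow> real \<Rightarrow> ('a \<Rightarrow> real) \<Rightarrow> bool"
  for V E p where
  base: "p \<in> graph_points V E \<Longrightarrow> graph_path V E p 0 p"
| step: "graph_path V E p l q \<Longrightarrow> is_cell V E v w \<Longrightarrow> q \<in> graph_cell v w \<Longrightarrow>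
         r \<in> graph_cell v w \<Longrightarrow> graph_path V E p (l + \<bar>q v - r v\<bar>) r"

text \<open>
  The value 0 outside the graph is only there because the locale \<open>Metric_space\<close> asks for
  nonnegativity of the distance function on the whole type.
\<close>

definition graph_dist ::
  "'a set \<Rightarrow> ('a \<Rightarrow> 'a \<Rightarrow> bool) \<Rightarrow> ('a \<Rightarrow> real) \<Rightarrow> ('a \<Rightarrow> real) \<Rightarrow> real" where
  "graph_dist V E p q =
     (if p \<in> graph_points V E \<and> q \<in> graph_points V E then Inf {l. graph_path V E p l q} else 0)"

definition graph_metric :: "'a set \<Rightarrow> ('a \<Rightarrow> 'a \<Rightarrow> bool) \<Rightarrow> ('a \<Rightarrow> real) metric" where
  "graph_metric V E = metric (graph_points V E, graph_dist V E)"

definition generating_set :: "('a, 'b) monoid_scheme \<Rightarrow> 'a set \<Rightarrow> bool" where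
  "generating_set G S \<longleftrightarrow> S \<subseteq> carrier G \<and> generate G S = carrier G"

definition finitely_generated :: "('a, 'b) monoid_scheme \<Rightarrow> bool" where
  "finitely_generated G \<longleftrightarrow> (\<exists>S. finite S \<and> generating_set G S)"

definition cayley_edge :: "('a, 'b) monoid_scheme \<Rightarrow> 'a set \<Rightarrow> 'a \<Rightarrow> 'a \<Rightarrow> bool" where
  "cayley_edge G S g g' \<longleftrightarrow> (\<exists>s\<in>S. g = s \<otimes>\<^bsub>G\<^esub> g' \<or> g' = s \<otimes>\<^bsub>G\<^esub> g)"

definition cayley_metric :: "('a, 'b) monoid_scheme \<Rightarrow> 'a set \<Rightarrow> ('a \<Rightarrow> real) metric" where
  "cayley_metric G S = graph_metric (carrier G) (cayley_edge G S)"

definition group_quasi_isometric_to :: "('a, 'b) monoid_scheme \<Rightarrow> 'c metric \<Rightarrow> bool" where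
  "group_quasi_isometric_to G Y \<longleftrightarrow>
     (\<exists>S f. finite S \<and> generating_set G S \<and> quasi_isometry (cayley_metric G S) Y f)"

definition virtually_infinite_cyclic :: "('a, 'b) monoid_scheme \<Rightarrow> bool" where
  "virtually_infinite_cyclic G \<longleftrightarrow>
     (\<exists>H. subgroup H G \<and> finite (rcosets\<^bsub>G\<^esub> H) \<and> G\<lparr>carrier := H\<rparr> \<cong> integer_group)"

text \<open>
  \<open>metric (M, d)\<close> is only meaningful once \<open>Metric_space M d\<close> is known; for Cayley graphs of
  generating sets this is established here.
\<close>

lemma graph_cell_commute: "graph_cell v w = graph_cell w v"
  by (simp add: graph_cell_def insert_commute)

lemma graph_cell_complement:
  assumes "p \<in> graph_cell v w" "v \<noteq> w" shows "p w = 1 - p v"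
  using assms by (simp add: graph_cell_def)

lemma graph_cell_diag: "p \<in> graph_cell v v \<longleftrightarrow> p = graph_vertex v"
  by (auto simp: graph_cell_def graph_vertex_def)

lemma graph_vertex_in_cell: "graph_vertex v \<in> graph_cell v w" "graph_vertex w \<in> graph_cell v w"
  by (auto simp: graph_cell_def graph_vertex_def sum.If_cases insert_commute split: if_splits)

lemma graph_vertex_in_points: "v \<in> V \<Longrightarrow> graph_vertex v \<in> graph_points V E"
  using graph_vertex_in_cell by (fastforce simp: graph_points_def is_cell_def)

lemma graph_path_endpoints:
  "graph_path V E p l q \<Longrightarrow> p \<in> graph_points V E \<and> q \<in> graph_points V E"
  by (induction rule: graph_path.induct) (auto simp: graph_points_def)

lemma graph_path_trans:
  assumes "graph_path V E p l q" "graph_path V E q m r"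
  shows "graph_path V E p (l + m) r"
  using assms(2)
proof (induction rule: graph_path.induct)
  case base
  then show ?case using assms(1) by simp
next
  case (step m q' v w r)
  show ?case
    using graph_path.step[OF step.IH step.hyps(2-4)] by (simp add: add.assoc)
qed

lemma graph_path_segment:
  assumes "is_cell V E v w" "p \<in> graph_cell v w" "q \<in> graph_cell v w"
  shows "graph_path V E p \<bar>p v - q v\<bar> q"
proof -
  have "graph_path V E p 0 p"
    using assms by (intro graph_path.base) (auto simp: graph_points_def)
  from graph_path.step[OF this assms] show ?thesis by simp
qed

lemma graph_path_sym:
  assumes "graph_path V E p l q" shows "graph_path V E q l p"
  using assms
proof (induction rule: graph_path.induct)
  case base
  then show ?case by (rule graph_path.base)
next
  case (step l q v w r)
  have "graph_path V E r \<bar>r v - q v\<bar> q"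
    using step.hyps by (intro graph_path_segment)
  from graph_path_trans[OF this step.IH] show ?case
    by (simp add: abs_minus_commute add.commute)
qed

lemma graph_path_nonneg: "graph_path V E p l q \<Longrightarrow> 0 \<le> l"
  by (induction rule: graph_path.induct) auto

lemma graph_path_coordinate:
  assumes "graph_path V E p l q" shows "\<bar>p x - q x\<bar> \<le> l"
  using assms
proof (induction rule: graph_path.induct)
  case (step l q v w r)
  have "\<bar>q x - r x\<bar> \<le> \<bar>q v - r v\<bar>"
  proof (cases "v \<noteq> w \<and> x = w")
    case True
    then have "q w = 1 - q v" "r w = 1 - r v"
      using graph_cell_complement[of q v w] graph_cell_complement[of r v w] step.hyps by auto
    with True show ?thesis by simp
  next
    case False
    then have "x = v \<or> x \<notin> {v, w}" by auto
    moreover have "q x = 0 \<and> r x = 0" if "x \<notin> {v, w}"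
      using that step.hyps(3,4) unfolding graph_cell_def by blast
    ultimately show ?thesis by force
  qed
  then show ?case using step.IH by linarith
qed simp

lemma graph_path_lengths_bdd_below: "bdd_below {l. graph_path V E p l q}"
  by (rule bdd_belowI[of _ 0]) (auto dest: graph_path_nonneg)

lemma graph_dist_le: "graph_path V E p l q \<Longrightarrow> graph_dist V E p q \<le> l"
  using graph_path_endpoints[of V E p l q]
  by (auto simp: graph_dist_def intro!: cInf_lower graph_path_lengths_bdd_below)

lemma Metric_space_graph:
  assumes connected: "\<And>v w. v \<in> V \<Longrightarrow> w \<in> V \<Longrightarrow>
    \<exists>l. graph_path V E (graph_vertex v) l (graph_vertex w)"
  shows "Metric_space (graph_points V E) (graph_dist V E)"
proof -
  have ex_path: "\<exists>l. graph_path V E p l q"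
    if pq: "p \<in> graph_points V E" "q \<in> graph_points V E" for p q
  proof -
    have near: "\<exists>v\<in>V. \<exists>l. graph_path V E p l (graph_vertex v)"
      if "p \<in> graph_points V E" for p
    proof -
      from that obtain v w where vw: "is_cell V E v w" "p \<in> graph_cell v w"
        by (auto simp: graph_points_def)
      with graph_path_segment[OF vw graph_vertex_in_cell(1)] show ?thesis
        by (auto simp: is_cell_def)
    qed
    from near[OF pq(1)] near[OF pq(2)] show ?thesis
      by (meson connected graph_path_sym graph_path_trans)
  qed
  have ge: "c \<le> graph_dist V E p q"
    if "p \<in> graph_points V E" "q \<in> graph_points V E" "\<And>l. graph_path V E p l q \<Longrightarrow> c \<le> l"
    for c p q
    using that ex_path[OF that(1,2)] by (auto simp: graph_dist_def intro!: cInf_greatest)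
  show ?thesis
  proof
    fix p q
    show "0 \<le> graph_dist V E p q"
    proof (cases "p \<in> graph_points V E \<and> q \<in> graph_points V E")
      case True
      then show ?thesis by (intro ge) (auto dest: graph_path_nonneg)
    qed (auto simp: graph_dist_def)
    have "{l. graph_path V E p l q} = {l. graph_path V E q l p}"
      using graph_path_sym by blast
    then show "graph_dist V E p q = graph_dist V E q p"
      by (auto simp: graph_dist_def)
  next
    fix p q
    assume pq: "p \<in> graph_points V E" "q \<in> graph_points V E"
    show "graph_dist V E p q = 0 \<longleftrightarrow> p = q"
    proof
      assume "graph_dist V E p q = 0"
      moreover have "\<bar>p x - q x\<bar> \<le> graph_dist V E p q" for x
        by (rule ge[OF pq graph_path_coordinate])
      ultimately show "p = q" by (intro ext) simp
    next
      assume "p = q"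
      then have "graph_dist V E p q \<le> 0"
        using graph_dist_le graph_path.base[OF pq(1)] by blast
      moreover have "0 \<le> graph_dist V E p q"
        by (rule ge[OF pq graph_path_nonneg])
      ultimately show "graph_dist V E p q = 0" by simp
    qed
  next
    fix p q r
    assume pqr: "p \<in> graph_points V E" "q \<in> graph_points V E" "r \<in> graph_points V E"
    have "graph_dist V E p r - l \<le> m" if "graph_path V E p l q" "graph_path V E q m r" for l m
      using graph_dist_le[OF graph_path_trans[OF that]] by simp
    then have "graph_dist V E p r - l \<le> graph_dist V E q r" if "graph_path V E p l q" for l
      using that by (intro ge pqr) auto
    then have "graph_dist V E p r - graph_dist V E q r \<le> l" if "graph_path V E p l q" for l
      using that by force
    then have "graph_dist V E p r - graph_dist V E q r \<le> graph_dist V E p q"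
      by (intro ge pqr) auto
    then show "graph_dist V E p r \<le> graph_dist V E p q + graph_dist V E q r" by simp
  qed
qed

lemma cayley_path_left_mult:
  assumes "group G" "S \<subseteq> carrier G" "h \<in> generate G S" "g \<in> carrier G"
  shows "\<exists>l. graph_path (carrier G) (cayley_edge G S) (graph_vertex g) l
           (graph_vertex (h \<otimes>\<^bsub>G\<^esub> g))"
  using assms(3,4)
proof (induction arbitrary: g rule: generate.induct)
  interpret group G by fact
  have edge: "\<exists>l. graph_path (carrier G) (cayley_edge G S) (graph_vertex a) l (graph_vertex b)"
    if "a \<in> carrier G" "b \<in> carrier G" "cayley_edge G S a b" for a b
    using that graph_path_segment[OF _ graph_vertex_in_cell, of _ _ a b]
    by (auto simp: is_cell_def)
  {
    case one
    then show ?case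
      using graph_path.base[OF graph_vertex_in_points[OF one]] by auto
  next
    case (incl h)
    then show ?case
      using assms(2) by (intro edge) (auto simp: cayley_edge_def)
  next
    case (inv h)
    then have "h \<in> carrier G" using assms(2) by blast
    with inv have "g = h \<otimes>\<^bsub>G\<^esub> (inv\<^bsub>G\<^esub> h \<otimes>\<^bsub>G\<^esub> g)"
      by (simp add: m_assoc[symmetric])
    with inv \<open>h \<in> carrier G\<close> show ?case
      by (intro edge) (auto simp: cayley_edge_def)
  next
    case (eng h1 h2)
    have h: "h1 \<in> carrier G" "h2 \<in> carrier G"
      using eng.hyps generate_in_carrier[OF assms(2)] by auto
    obtain l where "graph_path (carrier G) (cayley_edge G S) (graph_vertex g) l
        (graph_vertex (h2 \<otimes>\<^bsub>G\<^esub> g))"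
      using eng.IH(2)[OF eng.prems] by blast
    moreover obtain m where "graph_path (carrier G) (cayley_edge G S)
        (graph_vertex (h2 \<otimes>\<^bsub>G\<^esub> g)) m (graph_vertex (h1 \<otimes>\<^bsub>G\<^esub> (h2 \<otimes>\<^bsub>G\<^esub> g)))"
      using eng.IH(1)[of "h2 \<otimes>\<^bsub>G\<^esub> g"] h eng.prems by blast
    ultimately show ?case
      unfolding m_assoc[OF h eng.prems] by (blast intro: graph_path_trans)
  }
qed

lemma Metric_space_cayley:
  assumes "group G" "generating_set G S"
  shows "Metric_space (graph_points (carrier G) (cayley_edge G S))
           (graph_dist (carrier G) (cayley_edge G S))"
proof (rule Metric_space_graph)
  interpret group G by fact
  fix g h assume gh: "g \<in> carrier G" "h \<in> carrier G"
  then have "h \<otimes>\<^bsub>G\<^esub> inv\<^bsub>G\<^esub> g \<in> generate G S"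
    using assms(2) by (simp add: generating_set_def)
  from cayley_path_left_mult[OF assms(1) _ this gh(1)] assms(2) gh
  show "\<exists>l. graph_path (carrier G) (cayley_edge G S) (graph_vertex g) l (graph_vertex h)"
    by (simp add: generating_set_def m_assoc)
qed

lemma
  assumes "group G" "generating_set G S"
  shows mspace_cayley_metric:
      "mspace (cayley_metric G S) = graph_points (carrier G) (cayley_edge G S)"
    and mdist_cayley_metric:
      "mdist (cayley_metric G S) = graph_dist (carrier G) (cayley_edge G S)"
  using Metric_space.mspace_metric[OF Metric_space_cayley[OF assms]]
    Metric_space.mdist_metric[OF Metric_space_cayley[OF assms]]
  by (simp_all add: cayley_metric_def graph_metric_def)

end

theory Submission
  imports Defs "HOL-Algebra.Multiplicative_Group"
begin

text \<open>
  Let \<open>F\<close> be the quasi-isometry restricted to \<open>G\<close> and \<open>P = {x. 0 \<le> F x}\<close>. Right translations are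
  isometries, so the coarse boundary of \<open>P g\<close> lies near \<open>g\<close>; hence \<open>P g\<close> agrees, up to a finite set,
  with \<open>P\<close> or with its complement, and it is exactly determined outside a bounded neighbourhood of
  \<open>g\<close>. Infinitely many \<open>g\<close> fix the ends (composites of two elements that swap them do), and if such
  a \<open>g\<close> is far from the identity then \<open>P g \<subset> P\<close> or \<open>P \<subset> P g\<close>. In the first case (otherwise invert
  \<open>g\<close>) every orbit \<open>x g\<^sup>n\<close> crosses from the complement of \<open>P\<close> into \<open>P\<close>, so the finite set \<open>P - P g\<close>
  meets every coset of the infinite cyclic group generated by \<open>g\<close>.
\<close>

section \<open>Sets up to finite difference\<close>

definition almost_eq :: "'a set \<Rightarrow> 'a set \<Rightarrow> bool" where
  "almost_eq A B \<longleftrightarrow> finite (sym_diff A B)"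

lemma almost_eq_sym: "almost_eq A B \<Longrightarrow> almost_eq B A"
  by (simp add: almost_eq_def)

lemma almost_eq_trans:
  assumes "almost_eq A B" "almost_eq B C" shows "almost_eq A C"
proof -
  have "sym_diff A C \<subseteq> sym_diff A B \<union> sym_diff B C" by auto
  with assms show ?thesis
    unfolding almost_eq_def by (meson finite_UnI finite_subset)
qed

lemma almost_eq_r_coset:
  assumes "almost_eq A B" shows "almost_eq (A #>\<^bsub>G\<^esub> g) (B #>\<^bsub>G\<^esub> g)"
proof -
  have "sym_diff (A #>\<^bsub>G\<^esub> g) (B #>\<^bsub>G\<^esub> g) \<subseteq> (\<lambda>x. x \<otimes>\<^bsub>G\<^esub> g) ` sym_diff A B"
    by (auto simp: r_coset_def)
  with assms show ?thesis
    unfolding almost_eq_def by (meson finite_imageI finite_subset)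
qed

lemma (in group) mem_r_coset_iff:
  assumes "A \<subseteq> carrier G" "g \<in> carrier G" "x \<in> carrier G"
  shows "x \<in> A #> g \<longleftrightarrow> x \<otimes> inv g \<in> A"
proof
  assume "x \<otimes> inv g \<in> A"
  moreover have "x = (x \<otimes> inv g) \<otimes> g" using assms by (simp add: m_assoc)
  ultimately show "x \<in> A #> g" unfolding r_coset_def by blast
qed (use assms in \<open>auto simp: r_coset_def m_assoc subset_iff\<close>)

section \<open>Groups coarsely equivalent to the line\<close>

text \<open>What is kept of the quasi-isometry once the metric is dropped. Word distance depends
  only on \<open>x \<otimes> inv y\<close>, which right translation by \<open>g\<close> preserves;
  this is why the bound \<open>E\<close> in \<open>controlled\<close> is uniform in
  \<open>g\<close>. \<open>proper\<close> reflects the finiteness of balls, and \<open>dense\<close>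
  the quasi-dense image.\<close>

locale coarse_line = group G for G (structure) +
  fixes F :: "'a \<Rightarrow> real" and k :: real
  assumes controlled: "\<And>D. \<exists>E. \<forall>x\<in>carrier G. \<forall>y\<in>carrier G. \<forall>g\<in>carrier G.
      \<bar>F x - F y\<bar> \<le> D \<longrightarrow> \<bar>F (x \<otimes> g) - F (y \<otimes> g)\<bar> \<le> E"
    and proper: "\<And>r. finite {x \<in> carrier G. \<bar>F x\<bar> \<le> r}"
    and dense: "\<And>t. \<exists>x\<in>carrier G. \<bar>F x - t\<bar> \<le> k"
begin

definition pos :: "'a set" where
  "pos = {x \<in> carrier G. 0 \<le> F x}"

lemma pos_subset: "pos \<subseteq> carrier G"
  by (auto simp: pos_def)

lemma k_nonneg: "0 \<le> k"
  using dense[of 0] by force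

section \<open>Both ends of the group are infinite\<close>

lemma infinite_above: "infinite {x \<in> carrier G. a < F x}"
proof
  assume fin: "finite {x \<in> carrier G. a < F x}"
  define t where "t = Max (F ` insert \<one> {x \<in> carrier G. a < F x})"
  have t: "F x \<le> t" if "x \<in> carrier G" "a < F x" for x
    unfolding t_def using fin that by (intro Max_ge) auto
  \<comment> \<open>Even after an error of \<open>k\<close>, this height lies above both
    \<open>a\<close> and the supposed maximum \<open>t\<close>.\<close>
  obtain x where "x \<in> carrier G" "\<bar>F x - (\<bar>a\<bar> + \<bar>t\<bar> + k + 1)\<bar> \<le> k"
    using dense by blast
  with t[of x] show False by force
qed

lemma infinite_below: "infinite {x \<in> carrier G. F x < a}"
proof
  assume fin: "finite {x \<in> carrier G. F x < a}"
  define t where "t = Min (F ` insert \<one> {x \<in> carrier G. F x < a})"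
  have t: "t \<le> F x" if "x \<in> carrier G" "F x < a" for x
    unfolding t_def using fin that by (intro Min_le) auto
  obtain x where "x \<in> carrier G" "\<bar>F x - (- \<bar>a\<bar> - \<bar>t\<bar> - k - 1)\<bar> \<le> k"
    using dense by blast
  with t[of x] show False by force
qed

lemma infinite_carrier: "infinite (carrier G)"
  using infinite_above[of 0] by (auto elim: finite_subset[rotated])

section \<open>Right translates of the half-line \<open>pos\<close>\<close>

text \<open>Discrete connectedness of a half-line: the values of \<open>u\<close> are
  \<open>k\<close>-dense, so two points above \<open>a\<close> are joined by a chain above
  \<open>a\<close> with steps of at most \<open>2 * k + 1\<close>. Keeping \<open>u\<close> general
  allows both \<open>F\<close> and \<open>- F\<close>.\<close>

lemma constant_above:
  fixes u :: "'a \<Rightarrow> real"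
  assumes u: "\<And>t. \<exists>x\<in>carrier G. \<bar>u x - t\<bar> \<le> k"
    and step: "\<And>x y. \<lbrakk>x \<in> carrier G; y \<in> carrier G; a < u x; a < u y;
      \<bar>u x - u y\<bar> \<le> 2 * k + 1\<rbrakk> \<Longrightarrow> x \<in> Q \<longleftrightarrow> y \<in> Q"
    and xy: "x \<in> carrier G" "y \<in> carrier G" "a < u x" "a < u y"
  shows "x \<in> Q \<longleftrightarrow> y \<in> Q"
proof -
  have chain: "x \<in> Q \<longleftrightarrow> y \<in> Q"
    if "x \<in> carrier G" "y \<in> carrier G" "a < u x" "u x \<le> u y" "u y \<le> u x + real n" for n x y
    using that
  proof (induction n arbitrary: y)
    case 0
    then show ?case using step[of x y] k_nonneg by auto
  next
    case (Suc n)
    show ?case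
    proof (cases "u y \<le> u x + (2 * k + 1)")
      case True
      then show ?thesis using Suc.prems by (intro step) auto
    next
      case False
      \<comment> \<open>The target puts \<open>u z\<close> between \<open>u y - (2 * k + 1)\<close>
        and \<open>u y - 1\<close>: one admissible step from \<open>y\<close>, still above
        \<open>u x\<close>, and at least one unit lower, as the induction needs.\<close>
      obtain z where z: "z \<in> carrier G" "\<bar>u z - (u y - (k + 1))\<bar> \<le> k"
        using u by blast
      have "x \<in> Q \<longleftrightarrow> z \<in> Q"
        using z False Suc.prems by (intro Suc.IH) (auto simp: abs_le_iff)
      also have "z \<in> Q \<longleftrightarrow> y \<in> Q"
        using z False Suc.prems by (intro step) (auto simp: abs_le_iff)
      finally show ?thesis .
    qed
  qed
  obtain n :: nat where n: "\<bar>u x - u y\<bar> \<le> real n"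
    using real_arch_simple by blast
  show ?thesis
  proof (cases "u x \<le> u y")
    case True
    with n xy show ?thesis by (intro chain[where n = n]) auto
  next
    case False
    with n xy have "y \<in> Q \<longleftrightarrow> x \<in> Q" by (intro chain[where n = n]) auto
    then show ?thesis by simp
  qed
qed

text \<open>A short step can change membership in \<open>pos #> g\<close> only at a point whose
  \<open>F\<close>-value is close to \<open>F g\<close>, with a bound \<open>C\<close> chosen before
  \<open>g\<close>. Beyond that bound, on either side, membership is constant by
  \<open>constant_above\<close>.\<close>

lemma translate_constant:
  obtains C where "0 \<le> C"
    and "\<forall>g\<in>carrier G. \<forall>x\<in>carrier G. \<forall>y\<in>carrier G. F g + C < F x \<longrightarrow> F g + C < F y \<longrightarrow>
      (x \<in> pos #> g \<longleftrightarrow> y \<in> pos #> g)"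
    and "\<forall>g\<in>carrier G. \<forall>x\<in>carrier G. \<forall>y\<in>carrier G. F x < F g - C \<longrightarrow> F y < F g - C \<longrightarrow>
      (x \<in> pos #> g \<longleftrightarrow> y \<in> pos #> g)"
proof -
  obtain E where E: "\<And>x y g. \<lbrakk>x \<in> carrier G; y \<in> carrier G; g \<in> carrier G; \<bar>F x - F y\<bar> \<le> 2 * k + 1\<rbrakk>
      \<Longrightarrow> \<bar>F (x \<otimes> g) - F (y \<otimes> g)\<bar> \<le> E"
    using controlled[of "2 * k + 1"] by blast
  obtain C where C: "\<And>x y g. \<lbrakk>x \<in> carrier G; y \<in> carrier G; g \<in> carrier G; \<bar>F x - F y\<bar> \<le> E + \<bar>F \<one>\<bar>\<rbrakk>
      \<Longrightarrow> \<bar>F (x \<otimes> g) - F (y \<otimes> g)\<bar> \<le> C"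
    using controlled[of "E + \<bar>F \<one>\<bar>"] by blast
  \<comment> \<open>At a change exactly one of \<open>F (x \<otimes> inv g)\<close> and
    \<open>F (y \<otimes> inv g)\<close> is negative, and they differ by at most \<open>E\<close>.
    So \<open>x \<otimes> inv g\<close> is \<open>F\<close>-close to \<open>\<one>\<close>, and
    translating back by \<open>g\<close> makes \<open>x\<close> \<open>F\<close>-close to
    \<open>g\<close>.\<close>
  have cross: "\<bar>F x - F g\<bar> \<le> C"
    if "g \<in> carrier G" "x \<in> carrier G" "y \<in> carrier G" "\<bar>F x - F y\<bar> \<le> 2 * k + 1"
      "\<not> (x \<in> pos #> g \<longleftrightarrow> y \<in> pos #> g)" for g x y
  proof -
    have "\<not> (0 \<le> F (x \<otimes> inv g) \<longleftrightarrow> 0 \<le> F (y \<otimes> inv g))"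
      using that by (simp add: mem_r_coset_iff pos_subset) (simp add: pos_def)
    with E[of x y "inv g"] that have "\<bar>F (x \<otimes> inv g) - F \<one>\<bar> \<le> E + \<bar>F \<one>\<bar>"
      by auto
    from C[OF _ _ _ this, of g] that show ?thesis
      by (simp add: m_assoc)
  qed
  show ?thesis
  proof (rule that[of "\<bar>C\<bar>"]; (intro ballI impI)?)
    fix g x y
    assume A: "g \<in> carrier G" "x \<in> carrier G" "y \<in> carrier G" "F g + \<bar>C\<bar> < F x" "F g + \<bar>C\<bar> < F y"
    show "x \<in> pos #> g \<longleftrightarrow> y \<in> pos #> g"
    proof (rule constant_above[OF dense, of "F g + \<bar>C\<bar>"])
      fix x y
      assume "x \<in> carrier G" "y \<in> carrier G" "F g + \<bar>C\<bar> < F x" "\<bar>F x - F y\<bar> \<le> 2 * k + 1"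
      with cross[OF A(1), of x y] show "x \<in> pos #> g \<longleftrightarrow> y \<in> pos #> g"
        by linarith
    qed (use A in auto)
  next
    fix g x y
    assume A: "g \<in> carrier G" "x \<in> carrier G" "y \<in> carrier G" "F x < F g - \<bar>C\<bar>" "F y < F g - \<bar>C\<bar>"
    show "x \<in> pos #> g \<longleftrightarrow> y \<in> pos #> g"
    \<comment> \<open>The lower side is the upper side for the reflected function
      \<open>- F\<close>.\<close>
    proof (rule constant_above[of "\<lambda>x. - F x" "\<bar>C\<bar> - F g"])
      fix t
      show "\<exists>x\<in>carrier G. \<bar>- F x - t\<bar> \<le> k"
        using dense[of "- t"] by (auto simp: abs_le_iff)
    next
      fix x y
      assume "x \<in> carrier G" "y \<in> carrier G" "\<bar>C\<bar> - F g < - F x" "\<bar>- F x - - F y\<bar> \<le> 2 * k + 1"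
      with cross[OF A(1), of x y] show "x \<in> pos #> g \<longleftrightarrow> y \<in> pos #> g"
        by linarith
    qed (use A in auto)
  qed simp
qed

lemma almost_eqI_bounded:
  assumes "A \<subseteq> carrier G" "B \<subseteq> carrier G"
    and "\<And>x. x \<in> carrier G \<Longrightarrow> r < \<bar>F x\<bar> \<Longrightarrow> x \<in> A \<longleftrightarrow> x \<in> B"
  shows "almost_eq A B"
  unfolding almost_eq_def
  by (rule finite_subset[OF _ proper[of r]]) (use assms in \<open>force simp: not_less[symmetric]\<close>)

text \<open>Near each of the two ends membership in the translate is constant, which leaves four
  patterns. Those of the empty set and the whole group are impossible: translating back would make
  \<open>pos\<close> finite or cofinite.\<close>

lemma translate_almost_eq:
  assumes g: "g \<in> carrier G"
  shows "almost_eq (pos #> g) pos \<or> almost_eq (pos #> g) (carrier G - pos)"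
proof -
  let ?Q = "pos #> g"
  have Q: "?Q \<subseteq> carrier G"
    using g by (intro r_coset_subset_G pos_subset)
  obtain C where C: "0 \<le> C"
    "\<forall>g\<in>carrier G. \<forall>x\<in>carrier G. \<forall>y\<in>carrier G. F g + C < F x \<longrightarrow> F g + C < F y \<longrightarrow>
      (x \<in> pos #> g \<longleftrightarrow> y \<in> pos #> g)"
    "\<forall>g\<in>carrier G. \<forall>x\<in>carrier G. \<forall>y\<in>carrier G. F x < F g - C \<longrightarrow> F y < F g - C \<longrightarrow>
      (x \<in> pos #> g \<longleftrightarrow> y \<in> pos #> g)"
    by (rule translate_constant)
  note C = C(1) C(2,3)[rule_format]
  \<comment> \<open>Large enough that \<open>r < \<bar>F x\<bar>\<close> forces \<open>F x\<close>
    above \<open>F g + C\<close> or below \<open>F g - C\<close>.\<close>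
  define r where "r = \<bar>F g\<bar> + C"
  obtain b where b: "b \<in> carrier G" "F b > r"
    using infinite_imp_nonempty[OF infinite_above[of r]] by blast
  obtain c where c: "c \<in> carrier G" "F c < - r"
    using infinite_imp_nonempty[OF infinite_below[of "- r"]] by blast
  have sides: "(r < F x \<and> (x \<in> ?Q \<longleftrightarrow> b \<in> ?Q)) \<or> (F x < - r \<and> (x \<in> ?Q \<longleftrightarrow> c \<in> ?Q))"
    if "x \<in> carrier G" "r < \<bar>F x\<bar>" for x
  proof (cases "0 \<le> F x")
    case True
    then show ?thesis using that C(2)[OF g, of x b] b by (auto simp: r_def)
  next
    case False
    then show ?thesis using that C(3)[OF g, of x c] c by (auto simp: r_def)
  qed
  have r: "0 \<le> r" using C(1) by (simp add: r_def)
  have untranslate: "almost_eq pos (X #> inv g)" if "almost_eq ?Q X" for X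
    using almost_eq_r_coset[OF that, of G "inv g"] g pos_subset by (simp add: coset_mult_assoc)
  have "\<not> almost_eq ?Q {}"
  proof
    assume "almost_eq ?Q {}"
    from untranslate[OF this] have "finite pos"
      by (simp add: almost_eq_def r_coset_def)
    moreover have "{x \<in> carrier G. 0 < F x} \<subseteq> pos"
      by (auto simp: pos_def)
    ultimately show False
      using infinite_above[of 0] finite_subset by blast
  qed
  moreover have "\<not> almost_eq ?Q (carrier G)"
  proof
    assume "almost_eq ?Q (carrier G)"
    from untranslate[OF this] have "almost_eq pos (carrier G)"
      using g coset_join2[OF _ subgroup_self] by simp
    then have "finite (carrier G - pos)"
      by (simp add: almost_eq_def)
    moreover have "{x \<in> carrier G. F x < 0} \<subseteq> carrier G - pos"
      by (auto simp: pos_def)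
    ultimately show False
      using infinite_below[of 0] finite_subset by blast
  qed
  moreover consider "b \<in> ?Q" "c \<in> ?Q" | "b \<in> ?Q" "c \<notin> ?Q" | "b \<notin> ?Q" "c \<in> ?Q" | "b \<notin> ?Q" "c \<notin> ?Q"
    by blast
  then have "almost_eq ?Q (carrier G) \<or> almost_eq ?Q pos \<or> almost_eq ?Q (carrier G - pos)
      \<or> almost_eq ?Q {}"
  proof cases
    case 1
    then have "almost_eq ?Q (carrier G)"
      using sides Q by (intro almost_eqI_bounded[where r = r]) auto
    then show ?thesis by blast
  next
    case 2
    then have "almost_eq ?Q pos"
      using sides Q r pos_subset by (intro almost_eqI_bounded[where r = r]) (fastforce simp: pos_def)+
    then show ?thesis by blast
  next
    case 3
    then have "almost_eq ?Q (carrier G - pos)"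
      using sides Q r by (intro almost_eqI_bounded[where r = r]) (fastforce simp: pos_def)+
    then show ?thesis by blast
  next
    case 4
    then have "almost_eq ?Q {}"
      using sides Q by (intro almost_eqI_bounded[where r = r]) auto
    then show ?thesis by blast
  qed
  ultimately show ?thesis by blast
qed

section \<open>Elements that fix the two ends\<close>

text \<open>If only finitely many elements fixed the ends, infinitely many would swap them.
  Multiplying these by the inverse of one fixed swapping element \<open>g\<close> gives infinitely
  many that fix the ends.\<close>

lemma infinite_end_preserving: "infinite {g \<in> carrier G. almost_eq (pos #> g) pos}"
proof
  let ?A = "{g \<in> carrier G. almost_eq (pos #> g) pos}"
  assume fin: "finite ?A"
  then have inf: "infinite (carrier G - ?A)"
    using infinite_carrier by (simp add: Diff_infinite_finite)
  then obtain g where g: "g \<in> carrier G" "\<not> almost_eq (pos #> g) pos"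
    by (metis (mono_tags, lifting) Diff_iff ex_in_conv infinite_imp_nonempty mem_Collect_eq)
  have "almost_eq (pos #> g #> inv g) ((carrier G - pos) #> inv g)"
    using g translate_almost_eq by (intro almost_eq_r_coset) blast
  then have pos: "almost_eq pos ((carrier G - pos) #> inv g)"
    using g pos_subset by (simp add: coset_mult_assoc)
  \<comment> \<open>For swapping \<open>h\<close>, both \<open>pos #> h #> inv g\<close> and
    \<open>pos\<close> almost agree with the \<open>inv g\<close>-translate of the complement of
    \<open>pos\<close>, hence with each other.\<close>
  have "(\<lambda>h. h \<otimes> inv g) ` (carrier G - ?A) \<subseteq> ?A"
  proof (rule image_subsetI)
    fix h assume "h \<in> carrier G - ?A"
    then have h: "h \<in> carrier G" "\<not> almost_eq (pos #> h) pos" by auto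
    then have "almost_eq (pos #> h #> inv g) ((carrier G - pos) #> inv g)"
      using translate_almost_eq by (intro almost_eq_r_coset) blast
    then show "h \<otimes> inv g \<in> ?A"
      using h g pos_subset almost_eq_trans almost_eq_sym[OF pos] by (simp add: coset_mult_assoc)
  qed
  with fin have "finite ((\<lambda>h. h \<otimes> inv g) ` (carrier G - ?A))"
    by (rule rev_finite_subset)
  moreover have "inj_on (\<lambda>h. h \<otimes> inv g) (carrier G - ?A)"
    using g by (auto intro!: inj_onI)
  ultimately show False
    using inf finite_imageD by blast
qed

text \<open>An end-preserving \<open>g\<close> far from \<open>0\<close> under \<open>F\<close>
  gives nested half-lines. For \<open>0 < F g\<close> the translate by \<open>g\<close> lies inside
  \<open>pos\<close>; otherwise it contains \<open>pos\<close>, and \<open>inv g\<close> is used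
  instead.\<close>

lemma strict_translate:
  obtains g where "g \<in> carrier G" "pos #> g \<subset> pos" "finite (pos - (pos #> g))"
proof -
  obtain C where C: "0 \<le> C"
    "\<forall>g\<in>carrier G. \<forall>x\<in>carrier G. \<forall>y\<in>carrier G. F g + C < F x \<longrightarrow> F g + C < F y \<longrightarrow>
      (x \<in> pos #> g \<longleftrightarrow> y \<in> pos #> g)"
    "\<forall>g\<in>carrier G. \<forall>x\<in>carrier G. \<forall>y\<in>carrier G. F x < F g - C \<longrightarrow> F y < F g - C \<longrightarrow>
      (x \<in> pos #> g \<longleftrightarrow> y \<in> pos #> g)"
    by (rule translate_constant)
  note C = C(1) C(2,3)[rule_format]
  obtain g where g: "g \<in> carrier G" "almost_eq (pos #> g) pos" "C + 2 * k + 1 < \<bar>F g\<bar>"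
  proof -
    \<comment> \<open>Infinitely many elements fix the ends but only finitely many have bounded
      \<open>F\<close>. The margin \<open>2 * k + 1\<close> beyond \<open>C\<close> leaves room for
      the points \<open>z\<close> below that make the inclusions strict.\<close>
    have "\<not> {g \<in> carrier G. almost_eq (pos #> g) pos} \<subseteq> {x \<in> carrier G. \<bar>F x\<bar> \<le> C + 2 * k + 1}"
      using infinite_end_preserving proper finite_subset by blast
    then show ?thesis using that by force
  qed
  have Q: "pos #> g \<subseteq> carrier G"
    using g by (intro r_coset_subset_G pos_subset)
  have fin: "finite ((pos #> g) - pos)" "finite (pos - (pos #> g))"
    using g(2) by (auto simp: almost_eq_def)
  show ?thesis
  proof (cases "0 < F g")
    case True
    have low: "x \<notin> pos #> g" if x: "x \<in> carrier G" "F x < F g - C" for x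
    proof
      assume "x \<in> pos #> g"
      \<comment> \<open>By constancy below \<open>F g - C\<close>, one such point in the translate
        would bring in all of the negative side, against \<open>fin(1)\<close>.\<close>
      then have "{y \<in> carrier G. F y < 0} \<subseteq> (pos #> g) - pos"
        using C(3)[OF g(1) x(1)] x(2) True g(3) k_nonneg by (auto simp: pos_def)
      then show False
        using fin(1) infinite_below finite_subset by blast
    qed
    have "pos #> g \<subseteq> pos"
    proof
      fix x assume "x \<in> pos #> g"
      with low[of x] Q True g(3) k_nonneg show "x \<in> pos"
        by (force simp: pos_def)
    qed
    \<comment> \<open>Here \<open>F z\<close> lies between \<open>0\<close> and
      \<open>2 * k\<close>, thus in \<open>pos\<close> yet below \<open>F g - C\<close>.\<close>
    moreover obtain z where "z \<in> carrier G" "\<bar>F z - k\<bar> \<le> k"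
      using dense by blast
    then have "z \<in> pos" "z \<notin> pos #> g"
      using low[of z] True g(3) by (auto simp: pos_def abs_le_iff)
    ultimately show ?thesis
      using that g(1) fin(2) by blast
  next
    case False
    have high: "x \<in> pos #> g" if x: "x \<in> carrier G" "F g + C < F x" for x
    proof (rule ccontr)
      assume "x \<notin> pos #> g"
      then have "{y \<in> carrier G. 0 < F y} \<subseteq> pos - (pos #> g)"
        using C(2)[OF g(1) x(1)] x(2) False g(3) k_nonneg by (auto simp: pos_def)
      then show False
        using fin(2) infinite_above finite_subset by blast
    qed
    have "pos \<subseteq> pos #> g"
      using high False g(3) k_nonneg by (auto simp: pos_def)
    \<comment> \<open>Here \<open>F z\<close> lies between \<open>- 2 * k - 1\<close> and
      \<open>- 1\<close>, thus outside \<open>pos\<close> yet above \<open>F g + C\<close>.\<close>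
    moreover obtain z where "z \<in> carrier G" "\<bar>F z - (- k - 1)\<bar> \<le> k"
      using dense by blast
    then have z: "z \<in> carrier G" "z \<notin> pos" "z \<in> pos #> g"
      using high[of z] False g(3) by (auto simp: pos_def abs_le_iff)
    ultimately have 1: "pos #> inv g \<subseteq> pos #> g #> inv g"
      by (auto simp: r_coset_def)
    have 2: "pos #> g #> inv g = pos"
      using g(1) pos_subset by (simp add: coset_mult_assoc)
    have "z \<otimes> inv g \<in> pos" "z \<otimes> inv g \<notin> pos #> inv g"
      using z g(1) pos_subset by (auto simp: mem_r_coset_iff m_assoc)
    moreover have "finite (pos - (pos #> inv g))"
      using almost_eq_r_coset[OF g(2), of G "inv g"] by (simp add: 2 almost_eq_def)
    ultimately show ?thesis
      using that[of "inv g"] g(1) 1 2 by auto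
  qed
qed

section \<open>The infinite cyclic subgroup and its finite index\<close>

text \<open>A point \<open>p\<close> of \<open>pos - (pos #> g)\<close> has its forward orbit in
  \<open>pos\<close> and its strictly backward orbit outside, so no positive power of
  \<open>g\<close> is trivial. Every other orbit runs parallel to that of \<open>p\<close> and must
  cross as well.\<close>

lemma orbit_crosses:
  assumes g: "g \<in> carrier G" "pos #> g \<subset> pos"
  shows "ord g = 0"
    and "x \<in> carrier G \<Longrightarrow> \<exists>n::int. x \<otimes> g [^] n \<in> pos - (pos #> g)"
proof -
  have mult: "x \<otimes> g \<in> pos" if "x \<in> pos" for x
    using that g by (auto simp: r_coset_def)
  obtain p where p: "p \<in> pos" "p \<notin> pos #> g"
    using g by blast
  then have pG: "p \<in> carrier G" using pos_subset by auto
  have up: "p \<otimes> g [^] n \<in> pos" for n :: nat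
    using p(1) pG g(1) mult by (induction n) (auto simp: m_assoc[symmetric])
  have down: "p \<otimes> g [^] (- int (Suc n)) \<notin> pos" for n :: nat
  proof (induction n)
    case 0
    then show ?case
      using p(2) pG g(1) pos_subset by (simp add: mem_r_coset_iff int_pow_neg)
  next
    case (Suc n)
    have "p \<otimes> g [^] (- int (Suc (Suc n))) \<otimes> g = p \<otimes> g [^] (- int (Suc n))"
      using pG g(1) int_pow_mult[of g "- int (Suc (Suc n))" 1] by (simp add: m_assoc)
    with Suc mult show ?case by metis
  qed
  show ord: "ord g = 0"
  proof (rule ccontr)
    assume "ord g \<noteq> 0"
    then obtain n where n: "ord g = Suc n" by (cases "ord g") auto
    have "g [^] (- int (Suc n)) = \<one>"
      using g(1) by (simp add: int_pow_eq_id n[symmetric])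
    with down[of n] p(1) pG show False by simp
  qed
  have inj: "inj (\<lambda>n::int. p \<otimes> g [^] n)"
    using pG g(1) by (auto intro!: injI simp: int_pow_eq ord)
  \<comment> \<open>The orbit is injective and \<open>F\<close> is proper, so \<open>F\<close> is
    unbounded along it in each direction.\<close>
  have escape: "\<exists>n::nat. r < \<bar>F (p \<otimes> g [^] (s * int n))\<bar>" if "s \<noteq> 0" for r and s :: int
  proof (rule ccontr)
    assume "\<nexists>n::nat. r < \<bar>F (p \<otimes> g [^] (s * int n))\<bar>"
    then have "range (\<lambda>n::nat. p \<otimes> g [^] (s * int n)) \<subseteq> {x \<in> carrier G. \<bar>F x\<bar> \<le> r}"
      using pG g(1) by (auto simp: not_less)
    moreover have "inj (\<lambda>n::nat. p \<otimes> g [^] (s * int n))"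
      using that by (auto intro!: injI dest!: injD[OF inj])
    ultimately show False
      using proper finite_subset range_inj_infinite by blast
  qed
  show "\<exists>n::int. x \<otimes> g [^] n \<in> pos - (pos #> g)" if x: "x \<in> carrier G"
  proof -
    \<comment> \<open>Uniformity of \<open>controlled\<close> in the translating element gives one
      bound for all powers of \<open>g\<close>. Where \<open>F\<close> on the orbit of
      \<open>p\<close> exceeds it in absolute value, the orbit of \<open>x\<close> is on the same
      side.\<close>
    obtain E where E: "\<And>n::int. \<bar>F (x \<otimes> g [^] n) - F (p \<otimes> g [^] n)\<bar> \<le> E"
      using controlled[of "\<bar>F x - F p\<bar>"] x pG g(1) by (metis int_pow_closed order_refl)
    obtain m :: nat where "E < \<bar>F (p \<otimes> g [^] (1 * int m))\<bar>"
      using escape[of 1] by auto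
    with E[of "int m"] up[of m] have m: "x \<otimes> g [^] int m \<in> pos"
      using x g(1) by (auto simp: pos_def int_pow_int)
    \<comment> \<open>The summand \<open>\<bar>F p\<bar>\<close> excludes \<open>n = 0\<close>,
      where the orbit is still at \<open>p\<close> and \<open>down\<close> does not apply.\<close>
    obtain n :: nat where n: "\<bar>E\<bar> + \<bar>F p\<bar> < \<bar>F (p \<otimes> g [^] (- 1 * int n))\<bar>"
      using escape[of "-1"] by fastforce
    then have "n \<noteq> 0" using pG by (intro notI) simp
    then obtain n' where n': "n = Suc n'" by (cases n) auto
    with E[of "- int n"] down[of n'] n have n2: "x \<otimes> g [^] (- int n) \<notin> pos"
      using x pG g(1) by (auto simp: pos_def)
    \<comment> \<open>A discrete intermediate value argument between the exponents
      \<open>- int n\<close> and \<open>int m\<close>. Being outside \<open>pos\<close> at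
      \<open>j - 1\<close> means being outside \<open>pos #> g\<close> at \<open>j\<close>.\<close>
    have "\<exists>j::int. x \<otimes> g [^] j \<in> pos \<and> x \<otimes> g [^] (j - 1) \<notin> pos"
    proof (rule ccontr)
      assume no: "\<nexists>j::int. x \<otimes> g [^] j \<in> pos \<and> x \<otimes> g [^] (j - 1) \<notin> pos"
      have "x \<otimes> g [^] (- int n + int i) \<notin> pos" for i
      proof (induction i)
        case (Suc i)
        then show ?case
          using no[unfolded not_ex, rule_format, of "- int n + int (Suc i)"] by auto
      qed (use n2 in simp)
      from this[of "n + m"] m show False by simp
    qed
    then obtain j :: int where j: "x \<otimes> g [^] j \<in> pos" "x \<otimes> g [^] (j - 1) \<notin> pos"
      by blast
    moreover have "x \<otimes> g [^] (j - 1) = x \<otimes> g [^] j \<otimes> inv g"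
      using x g(1) by (simp add: int_pow_diff m_assoc)
    ultimately show ?thesis
      using x g(1) pos_subset by (auto simp: mem_r_coset_iff)
  qed
qed

end

text \<open>The set \<open>K\<close> meets every left coset of the powers of \<open>g\<close>, while
  \<open>rcosets\<close> are right cosets. Inversion exchanges the two, so the inverses of
  \<open>K\<close> represent all right cosets.\<close>

lemma (in group) virtually_infinite_cyclicI:
  assumes g: "g \<in> carrier G" "ord g = 0" and "finite K"
    and K: "\<And>x. x \<in> carrier G \<Longrightarrow> \<exists>n::int. x \<otimes> g [^] n \<in> K"
  shows "virtually_infinite_cyclic G"
proof -
  let ?H = "range (\<lambda>n::int. g [^] n)"
  have H: "subgroup ?H G"
    using g(1) by (rule subgroup_of_powers)
  have "rcosets ?H \<subseteq> (\<lambda>p. ?H #> inv p) ` K"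
  proof
    fix R assume "R \<in> rcosets ?H"
    then obtain x where x: "x \<in> carrier G" "R = ?H #> x"
      by (auto simp: RCOSETS_def)
    obtain n :: int where n: "inv x \<otimes> g [^] n \<in> K"
      using K x(1) by blast
    have "inv (inv x \<otimes> g [^] n) = g [^] (- n) \<otimes> x"
      using x(1) g(1) by (simp add: inv_mult_group int_pow_neg)
    moreover have "?H #> x = ?H #> (g [^] (- n) \<otimes> x)"
      using x(1) g(1) H by (intro repr_independence) (auto simp: r_coset_def)
    ultimately have "R = ?H #> inv (inv x \<otimes> g [^] n)"
      using x(2) by simp
    with n show "R \<in> (\<lambda>p. ?H #> inv p) ` K"
      by blast
  qed
  then have "finite (rcosets ?H)"
    using \<open>finite K\<close> finite_surj by blast
  moreover have "G\<lparr>carrier := ?H\<rparr> \<cong> integer_group"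
  proof (rule group.iso_sym[OF group_integer_group], rule is_isoI)
    show "(\<lambda>n::int. g [^] n) \<in> iso integer_group (G\<lparr>carrier := ?H\<rparr>)"
      using g by (auto simp: iso_def hom_def bij_betw_def int_pow_mult int_pow_eq intro!: injI)
  qed
  ultimately show ?thesis
    using H unfolding virtually_infinite_cyclic_def by blast
qed

lemma (in coarse_line) virtually_infinite_cyclic: "virtually_infinite_cyclic G"
proof -
  obtain g where g: "g \<in> carrier G" "pos #> g \<subset> pos" "finite (pos - (pos #> g))"
    by (rule strict_translate)
  show ?thesis
    by (rule virtually_infinite_cyclicI[OF g(1) _ g(3)]) (use orbit_crosses[OF g(1,2)] in blast)+
qed

section \<open>Word length and the Cayley graph\<close>

text \<open>Words grow on the left, matching the Cayley edges, which are left multiplications by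
  generators.\<close>

primrec word_ball :: "('a, 'b) monoid_scheme \<Rightarrow> 'a set \<Rightarrow> nat \<Rightarrow> 'a set" where
  "word_ball G S 0 = {\<one>\<^bsub>G\<^esub>}"
| "word_ball G S (Suc n) = word_ball G S n
     \<union> (\<Union>s\<in>S. (\<lambda>x. s \<otimes>\<^bsub>G\<^esub> x) ` word_ball G S n \<union> (\<lambda>x. inv\<^bsub>G\<^esub> s \<otimes>\<^bsub>G\<^esub> x) ` word_ball G S n)"

definition word_length :: "('a, 'b) monoid_scheme \<Rightarrow> 'a set \<Rightarrow> 'a \<Rightarrow> nat" where
  "word_length G S x = (LEAST n. x \<in> word_ball G S n)"

lemma finite_word_ball: "finite S \<Longrightarrow> finite (word_ball G S n)"
  by (induction n) auto

lemma word_ball_mono: "m \<le> n \<Longrightarrow> word_ball G S m \<subseteq> word_ball G S n"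
  by (induction rule: dec_induct) auto

context
  fixes G :: "('a, 'b) monoid_scheme" (structure) and S
  assumes G: "group G" and S: "generating_set G S"
begin

interpretation group G by (rule G)

lemma generator_in_carrier: "s \<in> S \<Longrightarrow> s \<in> carrier G"
  using S by (auto simp: generating_set_def)

lemma word_ball_carrier: "word_ball G S n \<subseteq> carrier G"
  by (induction n) (auto simp: generator_in_carrier)

lemma word_ball_mult:
  assumes "x \<in> word_ball G S m" "y \<in> word_ball G S n"
  shows "x \<otimes> y \<in> word_ball G S (m + n)"
  using assms
proof (induction m arbitrary: x)
  case 0
  then show ?case using word_ball_carrier[of n] by (auto simp: subset_iff)
next
  case (Suc m)
  have y: "y \<in> carrier G" using Suc.prems word_ball_carrier by auto
  from Suc.prems(1) consider "x \<in> word_ball G S m"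
    | s z where "s \<in> S" "z \<in> word_ball G S m" "x = s \<otimes> z \<or> x = inv s \<otimes> z"
    by auto
  then show ?case
  proof cases
    case 1
    then show ?thesis using Suc by auto
  next
    case 2
    then have "x \<otimes> y = s \<otimes> (z \<otimes> y) \<or> x \<otimes> y = inv s \<otimes> (z \<otimes> y)"
      using y word_ball_carrier by (auto simp: m_assoc generator_in_carrier subset_iff)
    moreover have "z \<otimes> y \<in> word_ball G S (m + n)"
      using 2 Suc by auto
    ultimately show ?thesis using \<open>s \<in> S\<close> by auto
  qed
qed

lemma ex_word_ball: "x \<in> carrier G \<Longrightarrow> \<exists>n. x \<in> word_ball G S n"
proof -
  assume "x \<in> carrier G"
  then have "x \<in> generate G S" using S by (simp add: generating_set_def)
  then show ?thesis
  proof (induction rule: generate.induct)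
    case one
    show ?case by (rule exI[of _ 0]) simp
  next
    case (incl h)
    then have "h \<in> word_ball G S (Suc 0)" by (force simp: generator_in_carrier)
    then show ?case by blast
  next
    case (inv h)
    then have "inv h \<in> word_ball G S (Suc 0)" by (force simp: generator_in_carrier)
    then show ?case by blast
  next
    case (eng h1 h2)
    then show ?case using word_ball_mult by blast
  qed
qed

lemma word_length_in_ball: "x \<in> carrier G \<Longrightarrow> x \<in> word_ball G S (word_length G S x)"
  unfolding word_length_def using ex_word_ball by (metis LeastI_ex)

lemma word_length_le: "x \<in> word_ball G S n \<Longrightarrow> word_length G S x \<le> n"
  unfolding word_length_def by (rule Least_le)

text \<open>Left multiplication by \<open>s\<close> is undone by \<open>inv s\<close>, also one
  letter, so the bound holds both ways. This makes word length 1-Lipschitz across Cayley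
  edges.\<close>

lemma word_length_mult_generator:
  assumes "x \<in> carrier G" "s \<in> S"
  shows "\<bar>real (word_length G S (s \<otimes> x)) - real (word_length G S x)\<bar> \<le> 1"
proof -
  have "s \<otimes> x \<in> word_ball G S (Suc (word_length G S x))"
    using word_length_in_ball[OF assms(1)] assms(2) by auto
  then have 1: "word_length G S (s \<otimes> x) \<le> Suc (word_length G S x)"
    by (rule word_length_le)
  have "inv s \<otimes> (s \<otimes> x) \<in> word_ball G S (Suc (word_length G S (s \<otimes> x)))"
    using word_length_in_ball[of "s \<otimes> x"] assms by (auto simp: generator_in_carrier)
  then have "x \<in> word_ball G S (Suc (word_length G S (s \<otimes> x)))"
    using assms by (simp add: m_assoc[symmetric] generator_in_carrier)
  from word_length_le[OF this] 1 show ?thesis by simp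
qed

end

section \<open>Path distance between vertices as word length\<close>

text \<open>A point can lie in several cells; summing over its support makes the value independent
  of the cell, and any cell containing the point may be used to compute it.\<close>

lemma graph_cell_support_sum:
  assumes "q \<in> graph_cell v w"
  shows "(\<Sum>x | q x \<noteq> 0. q x * n x) = (\<Sum>x\<in>{v, w}. q x * n x)"
  using assms by (intro sum.mono_neutral_left) (auto simp: graph_cell_def)

text \<open>The sums below evaluate the affine extension of \<open>n\<close> from the vertices to the graph.\<close>

lemma graph_path_lipschitz:
  fixes n :: "'a \<Rightarrow> real"
  assumes lip: "\<And>v w. \<lbrakk>v \<in> V; w \<in> V; E v w\<rbrakk> \<Longrightarrow> \<bar>n v - n w\<bar> \<le> 1"
    and "graph_path V E p l q"
  shows "\<bar>(\<Sum>x | p x \<noteq> 0. p x * n x) - (\<Sum>x | q x \<noteq> 0. q x * n x)\<bar> \<le> l"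
  using assms(2)
proof (induction rule: graph_path.induct)
  case (step l q v w r)
  have "\<bar>(\<Sum>x | q x \<noteq> 0. q x * n x) - (\<Sum>x | r x \<noteq> 0. r x * n x)\<bar> \<le> \<bar>q v - r v\<bar>"
  proof (cases "v = w")
    case True
    with step.hyps have "q = r" by (simp add: graph_cell_diag)
    then show ?thesis by simp
  next
    case False
    then have compl: "q w = 1 - q v" "r w = 1 - r v"
      using step.hyps(3,4) by (auto intro: graph_cell_complement)
    \<comment> \<open>Within one cell the extension is affine in the coordinate at \<open>v\<close>,
      with slope \<open>n v - n w\<close>.\<close>
    have "(\<Sum>x | q x \<noteq> 0. q x * n x) - (\<Sum>x | r x \<noteq> 0. r x * n x) = (q v - r v) * (n v - n w)"
      unfolding graph_cell_support_sum[OF step.hyps(3)] graph_cell_support_sum[OF step.hyps(4)]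
      using False by (simp add: compl) (simp add: algebra_simps)
    moreover have "\<bar>n v - n w\<bar> \<le> 1"
      using False step.hyps(2) by (intro lip) (auto simp: is_cell_def)
    ultimately show ?thesis
      by (simp add: abs_mult mult_left_le)
  qed
  with step.IH show ?case by linarith
qed simp

text \<open>The Lipschitz bound holds for every path length, hence for the infimum; the given path
  ensures that the set of lengths is nonempty.\<close>

lemma graph_dist_vertex_ge:
  fixes n :: "'a \<Rightarrow> real"
  assumes "\<And>v w. \<lbrakk>v \<in> V; w \<in> V; E v w\<rbrakk> \<Longrightarrow> \<bar>n v - n w\<bar> \<le> 1"
    and "x \<in> V" "y \<in> V" "graph_path V E (graph_vertex x) l (graph_vertex y)"
  shows "\<bar>n x - n y\<bar> \<le> graph_dist V E (graph_vertex x) (graph_vertex y)"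
proof -
  have vertex: "(\<Sum>z | graph_vertex v z \<noteq> 0. graph_vertex v z * n z) = n v" for v
    by (simp add: graph_vertex_def)
  have "\<bar>n x - n y\<bar> \<le> l" if "graph_path V E (graph_vertex x) l (graph_vertex y)" for l
    using graph_path_lipschitz[of V E n, OF assms(1) that] by (simp only: vertex)
  then show ?thesis
    using assms(2-4) unfolding graph_dist_def
    by (auto simp: graph_vertex_in_points intro!: cInf_greatest)
qed

lemma graph_path_word_ball:
  assumes G: "group G" and S: "generating_set G S"
    and "x \<in> word_ball G S n" "y \<in> carrier G"
  shows "\<exists>l\<le>real n. graph_path (carrier G) (cayley_edge G S) (graph_vertex (x \<otimes>\<^bsub>G\<^esub> y)) l (graph_vertex y)"
  using assms(3)
proof (induction n arbitrary: x)
  interpret group G by fact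
  case 0
  then show ?case
    using assms(4) graph_path.base[OF graph_vertex_in_points[OF assms(4)]] by auto
next
  interpret group G by fact
  case (Suc n)
  from Suc.prems consider "x \<in> word_ball G S n"
    | s z where "s \<in> S" "z \<in> word_ball G S n" "x = s \<otimes>\<^bsub>G\<^esub> z \<or> x = inv\<^bsub>G\<^esub> s \<otimes>\<^bsub>G\<^esub> z"
    by auto
  then show ?case
  proof cases
    case 1
    from Suc.IH[OF this] show ?thesis by (meson le_SucI of_nat_le_iff order_trans order_refl)
  next
    case 2
    then have z: "z \<in> carrier G" "s \<in> carrier G"
      using word_ball_carrier[OF G S] generator_in_carrier[OF G S] by auto
    obtain l where l: "l \<le> real n"
      "graph_path (carrier G) (cayley_edge G S) (graph_vertex (z \<otimes>\<^bsub>G\<^esub> y)) l (graph_vertex y)"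
      using Suc.IH 2 by blast
    have "cayley_edge G S (x \<otimes>\<^bsub>G\<^esub> y) (z \<otimes>\<^bsub>G\<^esub> y)"
    proof -
      have "x \<otimes>\<^bsub>G\<^esub> y = s \<otimes>\<^bsub>G\<^esub> (z \<otimes>\<^bsub>G\<^esub> y) \<or> z \<otimes>\<^bsub>G\<^esub> y = s \<otimes>\<^bsub>G\<^esub> (x \<otimes>\<^bsub>G\<^esub> y)"
        using 2(3) z assms(4) by (auto simp: m_assoc[symmetric])
      then show ?thesis using 2(1) by (auto simp: cayley_edge_def)
    qed
    moreover have "x \<in> carrier G"
      using 2(3) z by auto
    ultimately have "is_cell (carrier G) (cayley_edge G S) (x \<otimes>\<^bsub>G\<^esub> y) (z \<otimes>\<^bsub>G\<^esub> y)"
      using z assms(4) by (simp add: is_cell_def)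
    \<comment> \<open>The segment has length 1, or 0 when both vertices coincide; hence only
      \<open>m \<le> 1\<close>.\<close>
    from graph_path_segment[OF this graph_vertex_in_cell] obtain m where m: "m \<le> 1"
      "graph_path (carrier G) (cayley_edge G S) (graph_vertex (x \<otimes>\<^bsub>G\<^esub> y)) m (graph_vertex (z \<otimes>\<^bsub>G\<^esub> y))"
      by (rule that[rotated]) (simp add: graph_vertex_def)
    show ?thesis
      using graph_path_trans[OF m(2) l(2)] m(1) l(1) by (intro exI[of _ "m + l"]) auto
  qed
qed

text \<open>Spelling a shortest word gives a path for the upper bound. The lower bound comes from
  the 1-Lipschitz function \<open>?n\<close>, which vanishes at \<open>y\<close>.\<close>

lemma graph_dist_word_length:
  assumes G: "group G" and S: "generating_set G S" and x: "x \<in> carrier G" and y: "y \<in> carrier G"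
  shows "graph_dist (carrier G) (cayley_edge G S) (graph_vertex x) (graph_vertex y)
    = real (word_length G S (x \<otimes>\<^bsub>G\<^esub> inv\<^bsub>G\<^esub> y))"
proof -
  interpret group G by fact
  let ?n = "\<lambda>v. real (word_length G S (v \<otimes>\<^bsub>G\<^esub> inv\<^bsub>G\<^esub> y))"
  have "x \<otimes>\<^bsub>G\<^esub> inv\<^bsub>G\<^esub> y \<otimes>\<^bsub>G\<^esub> y = x"
    using x y by (simp add: m_assoc)
  then obtain l where l: "l \<le> ?n x"
    "graph_path (carrier G) (cayley_edge G S) (graph_vertex x) l (graph_vertex y)"
    using graph_path_word_ball[OF G S word_length_in_ball[OF G S] y, of "x \<otimes>\<^bsub>G\<^esub> inv\<^bsub>G\<^esub> y"] x y by auto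
  have "\<bar>?n v - ?n w\<bar> \<le> 1"
    if v: "v \<in> carrier G" and w: "w \<in> carrier G" and "cayley_edge G S v w" for v w
  proof -
    from that(3) obtain s where s: "s \<in> S" "v = s \<otimes>\<^bsub>G\<^esub> w \<or> w = s \<otimes>\<^bsub>G\<^esub> v"
      by (auto simp: cayley_edge_def)
    then show ?thesis
      using word_length_mult_generator[OF G S, of "w \<otimes>\<^bsub>G\<^esub> inv\<^bsub>G\<^esub> y" s]
        word_length_mult_generator[OF G S, of "v \<otimes>\<^bsub>G\<^esub> inv\<^bsub>G\<^esub> y" s] v w y generator_in_carrier[OF G S]
      by (auto simp: m_assoc abs_minus_commute)
  qed
  from graph_dist_vertex_ge[of "carrier G" "cayley_edge G S" ?n, OF this x y l(2)]
  have "\<bar>?n x - ?n y\<bar> \<le> graph_dist (carrier G) (cayley_edge G S) (graph_vertex x) (graph_vertex y)" .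
  moreover have "word_length G S \<one>\<^bsub>G\<^esub> = 0"
    using word_length_le[OF G S, of "\<one>\<^bsub>G\<^esub>" 0] by simp
  ultimately show ?thesis
    using graph_dist_le[OF l(2)] l(1) y by simp
qed

lemma graph_point_near_vertex:
  assumes "p \<in> graph_points V E"
  obtains v where "v \<in> V" "graph_dist V E p (graph_vertex v) \<le> 1"
proof -
  from assms obtain v w where vw: "is_cell V E v w" "p \<in> graph_cell v w"
    by (auto simp: graph_points_def)
  have "p v \<le> 1" "0 \<le> p v"
    using vw(2) sum_nonneg_leq_bound[of "{v, w}" p 1 v] by (auto simp: graph_cell_def)
  with graph_dist_le[OF graph_path_segment[OF vw graph_vertex_in_cell(1)]]
  have "graph_dist V E p (graph_vertex v) \<le> 1"
    by (simp add: graph_vertex_def)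
  then show ?thesis using that vw(1) by (auto simp: is_cell_def)
qed

section \<open>From a quasi-isometry of the Cayley graph to a coarse line\<close>

lemma coarse_line_of_quasi_isometry:
  assumes G: "group G" and S: "generating_set G S" and "finite S"
    and qi: "quasi_isometry (cayley_metric G S) (euclidean_metric :: real metric) f"
  shows "\<exists>k. coarse_line G (f \<circ> graph_vertex) k"
proof -
  interpret group G by fact
  let ?P = "graph_points (carrier G) (cayley_edge G S)"
  let ?d = "graph_dist (carrier G) (cayley_edge G S)"
  let ?len = "\<lambda>x. real (word_length G S x)"
  let ?F = "f \<circ> graph_vertex"
  obtain L \<epsilon> k where L: "1 \<le> L" and \<epsilon>: "0 \<le> \<epsilon>"
    and lo: "\<And>a b. \<lbrakk>a \<in> ?P; b \<in> ?P\<rbrakk> \<Longrightarrow> 1 / L * ?d a b - \<epsilon> \<le> \<bar>f a - f b\<bar>"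
    and up: "\<And>a b. \<lbrakk>a \<in> ?P; b \<in> ?P\<rbrakk> \<Longrightarrow> \<bar>f a - f b\<bar> \<le> L * ?d a b + \<epsilon>"
    and k: "\<And>t. \<exists>a\<in>?P. \<bar>t - f a\<bar> \<le> k"
  proof -
    obtain L \<epsilon> where "1 \<le> L" "0 \<le> \<epsilon>"
      "\<forall>a\<in>?P. \<forall>b\<in>?P. 1 / L * ?d a b - \<epsilon> \<le> \<bar>f a - f b\<bar> \<and> \<bar>f a - f b\<bar> \<le> L * ?d a b + \<epsilon>"
      using qi unfolding quasi_isometry_def quasi_isometric_embedding_def
      by (auto simp: mspace_cayley_metric[OF G S] mdist_cayley_metric[OF G S] dist_real_def)
    moreover obtain k where "\<forall>t. \<exists>a\<in>?P. \<bar>t - f a\<bar> \<le> k"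
      using qi unfolding quasi_isometry_def quasi_dense_def
      by (auto simp: mspace_cayley_metric[OF G S] dist_real_def)
    ultimately show ?thesis
      using that[of L \<epsilon> k] by blast
  qed
  have Flo: "?len (x \<otimes>\<^bsub>G\<^esub> inv\<^bsub>G\<^esub> y) \<le> L * (\<bar>?F x - ?F y\<bar> + \<epsilon>)"
    if "x \<in> carrier G" "y \<in> carrier G" for x y
    using lo[of "graph_vertex x" "graph_vertex y"] that L
    by (simp add: graph_vertex_in_points graph_dist_word_length[OF G S] field_simps)
  have Fup: "\<bar>?F x - ?F y\<bar> \<le> L * ?len (x \<otimes>\<^bsub>G\<^esub> inv\<^bsub>G\<^esub> y) + \<epsilon>"
    if "x \<in> carrier G" "y \<in> carrier G" for x y
    using up[of "graph_vertex x" "graph_vertex y"] that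
    by (simp add: graph_vertex_in_points graph_dist_word_length[OF G S])
  have "coarse_line G ?F (k + (L + \<epsilon>))"
  proof
    fix D
    \<comment> \<open>The lower quasi-isometry bound turns \<open>D\<close> into a word length of at
      most \<open>L * (D + \<epsilon>)\<close>. Since \<open>g\<close> cancels in \<open>eq\<close>,
      the upper bound then applies to the translated pair.\<close>
    have "\<bar>?F (x \<otimes>\<^bsub>G\<^esub> g) - ?F (y \<otimes>\<^bsub>G\<^esub> g)\<bar> \<le> L * (L * (D + \<epsilon>)) + \<epsilon>"
      if xyg: "x \<in> carrier G" "y \<in> carrier G" "g \<in> carrier G" and D: "\<bar>?F x - ?F y\<bar> \<le> D" for x y g
    proof -
      have "x \<otimes>\<^bsub>G\<^esub> g \<otimes>\<^bsub>G\<^esub> inv\<^bsub>G\<^esub> (y \<otimes>\<^bsub>G\<^esub> g) = x \<otimes>\<^bsub>G\<^esub> (g \<otimes>\<^bsub>G\<^esub> inv\<^bsub>G\<^esub> g) \<otimes>\<^bsub>G\<^esub> inv\<^bsub>G\<^esub> y"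
        using xyg(1,2,3) by (simp only: inv_mult_group m_assoc m_closed inv_closed)
      then have eq: "x \<otimes>\<^bsub>G\<^esub> g \<otimes>\<^bsub>G\<^esub> inv\<^bsub>G\<^esub> (y \<otimes>\<^bsub>G\<^esub> g) = x \<otimes>\<^bsub>G\<^esub> inv\<^bsub>G\<^esub> y"
        using xyg by simp
      have "?len (x \<otimes>\<^bsub>G\<^esub> inv\<^bsub>G\<^esub> y) \<le> L * (D + \<epsilon>)"
        using Flo[OF xyg(1,2)] D L by (smt (verit) mult_left_mono)
      then have "L * ?len (x \<otimes>\<^bsub>G\<^esub> inv\<^bsub>G\<^esub> y) \<le> L * (L * (D + \<epsilon>))"
        using L by (intro mult_left_mono) auto
      with Fup[of "x \<otimes>\<^bsub>G\<^esub> g" "y \<otimes>\<^bsub>G\<^esub> g"] xyg show ?thesis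
        unfolding eq by simp
    qed
    then show "\<exists>E. \<forall>x\<in>carrier G. \<forall>y\<in>carrier G. \<forall>g\<in>carrier G.
        \<bar>?F x - ?F y\<bar> \<le> D \<longrightarrow> \<bar>?F (x \<otimes>\<^bsub>G\<^esub> g) - ?F (y \<otimes>\<^bsub>G\<^esub> g)\<bar> \<le> E"
      by blast
  next
    fix r
    \<comment> \<open>By \<open>Flo\<close> with \<open>y\<close> the identity, every
      \<open>x\<close> with \<open>\<bar>?F x\<bar> \<le> r\<close> has at most this word
      length.\<close>
    define N where "N = nat \<lceil>L * (r + \<bar>?F \<one>\<^bsub>G\<^esub>\<bar> + \<epsilon>)\<rceil>"
    have "{x \<in> carrier G. \<bar>?F x\<bar> \<le> r} \<subseteq> word_ball G S N"
    proof
      fix x assume x: "x \<in> {x \<in> carrier G. \<bar>?F x\<bar> \<le> r}"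
      then have "\<bar>?F x - ?F \<one>\<^bsub>G\<^esub>\<bar> + \<epsilon> \<le> r + \<bar>?F \<one>\<^bsub>G\<^esub>\<bar> + \<epsilon>" by auto
      then have "L * (\<bar>?F x - ?F \<one>\<^bsub>G\<^esub>\<bar> + \<epsilon>) \<le> L * (r + \<bar>?F \<one>\<^bsub>G\<^esub>\<bar> + \<epsilon>)"
        using L by (intro mult_left_mono) auto
      with Flo[of x "\<one>\<^bsub>G\<^esub>"] x have "?len x \<le> L * (r + \<bar>?F \<one>\<^bsub>G\<^esub>\<bar> + \<epsilon>)"
        by simp
      then have "word_length G S x \<le> N"
        unfolding N_def by linarith
      then show "x \<in> word_ball G S N"
        using word_length_in_ball[OF G S, of x] x by (auto intro: subsetD[OF word_ball_mono])
    qed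
    then show "finite {x \<in> carrier G. \<bar>?F x\<bar> \<le> r}"
      using finite_word_ball[OF \<open>finite S\<close>] finite_subset by blast
  next
    fix t
    obtain a where a: "a \<in> ?P" "\<bar>t - f a\<bar> \<le> k"
      using k by blast
    \<comment> \<open>The point \<open>a\<close> may be interior to an edge. Moving to a vertex
      costs distance at most 1, hence at most \<open>L + \<epsilon>\<close> under \<open>f\<close>,
      which accounts for the constant \<open>k + (L + \<epsilon>)\<close>.\<close>
    obtain v where v: "v \<in> carrier G" "?d a (graph_vertex v) \<le> 1"
      using graph_point_near_vertex[OF a(1)] .
    have "\<bar>f a - ?F v\<bar> \<le> L * ?d a (graph_vertex v) + \<epsilon>"
      using up[OF a(1) graph_vertex_in_points[OF v(1)]] by simp
    also have "L * ?d a (graph_vertex v) \<le> L"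
      using v(2) L by (simp add: mult_left_le)
    finally have "\<bar>?F v - t\<bar> \<le> k + (L + \<epsilon>)"
      using a(2) by linarith
    with v(1) show "\<exists>x\<in>carrier G. \<bar>?F x - t\<bar> \<le> k + (L + \<epsilon>)"
      by blast
  qed
  then show ?thesis by blast
qed

theorem mainTheorem1:
  fixes G :: "('a, 'b) monoid_scheme"
  assumes "group G"
    and "finitely_generated G"
    and "group_quasi_isometric_to G (euclidean_metric :: real metric)"
  shows "virtually_infinite_cyclic G"
proof -
  from assms(3) obtain S f where "finite S" "generating_set G S"
    "quasi_isometry (cayley_metric G S) (euclidean_metric :: real metric) f"
    unfolding group_quasi_isometric_to_def by blast
  with coarse_line_of_quasi_isometry[OF assms(1)] show ?thesis
    using coarse_line.virtually_infinite_cyclic by blast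
qed

end
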